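(* Let $q$ be a prime power, let $Q$ be a type of finite classical polar spaces over $\mathbb{F}_q$, let $r\ge t\ge 2$ and $k\in\{0,\ldots,r\}$, and let $\lambda\in\{1,\ldots,\lambda_{\max}\}$ where $\lambda_{\max}=\begin{bmatrix} r-t\\ k-t\end{bmatrix}_Q$. The admissible parameters $t$-$(r,k,\lambda)_Q$ for which the number of blocks $\lambda_0$ is less than or equal to the number $\begin{bmatrix} r\\ 1\end{bmatrix}_Q$ of points of the polar space of type $Q$ and rank $r$ are exactly the following: (i) $2$-$(r,r,1)_{\Omega(q)}$ and $2$-$(r,r,1)_{\mathrm{Sp}(q)}$ with $r\ge 2$; (ii) $2$-$(r,r,\lambda)_{U^+(q)}$ with $\lambda=1$ for $r=2$, or $\lambda\in\{1,\ldots,\sqrt q\}$ for $r\ge 3$; (iii) $2$-$(r,r,\lambda)_{\Omega^+(q)}$ with $\lambda=1$ for $r=2$, or $\lambda\in\{1,2\}$ for $r=3$, or $\lambda\in\{1,\ldots,q+1\}$ for $r\ge 4$; (iv) $3$-$(r,r,1)_{\Omega^+(q)}$ with $r\in\{3,4\}$. Moreover, equality $\lambda_0=\begin{bmatrix} r\\ 1\end{bmatrix}_Q$ occurs precisely for $2$-$(2,2,1)_{\Omega(q)}$, $2$-$(2,2,1)_{\mathrm{Sp}(q)}$, $3$-$(4,4,1)_{\Omega^+(q)}$ and $2$-$(4,4,q+1)_{\Omega^+(q)}$ (the latter being the reduced parameters of $3$-$(4,4,1)_{\Omega^+(q)}$).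
   Context: The types $Q$ of finite classical polar spaces over $\mathbb{F}_q$, each with a parameter $\epsilon$, are: symplectic $\mathrm{Sp}(q)$ ($\epsilon=0$); Hermitian $U^+(q)$ ($q$ a square, $\epsilon=-1/2$, ambient dimension $2r$ in rank $r$); Hermitian $U^-(q)$ ($q$ a square, $\epsilon=1/2$, ambient dimension $2r+1$); hyperbolic $\Omega^+(q)$ ($\epsilon=-1$); parabolic $\Omega(q)$ ($\epsilon=0$); elliptic $\Omega^-(q)$ ($\epsilon=1$). $\begin{bmatrix} m\\ k\end{bmatrix}_q$ is the Gaussian binomial coefficient (number of $k$-dimensional subspaces of $\mathbb{F}_q^m$, and $0$ if $k<0$ or $k>m$). $\begin{bmatrix} m\\ k\end{bmatrix}_Q=\begin{bmatrix} m\\ k\end{bmatrix}_q\prod_{i=m-k+1}^{m}(q^{i+\epsilon}+1)$ (and $0$ if $k<0$ or $k>m$) is the number of $k$-dimensional subspaces in a polar space of type $Q$ and rank $m$; in particular $\lambda_{\max}=0$ for $k<t$, so $\lambda\in\{1,\ldots,\lambda_{\max}\}$ forces $t\le k$. For parameters $t$-$(r,k,\lambda)_Q$ with $t\le k$ and $s\in\{0,\ldots,t\}$ put $\lambda_s=\lambda\cdot\begin{bmatrix} r-s\\ t-s\end{bmatrix}_Q\Big/\begin{bmatrix} k-s\\ t-s\end{bmatrix}_q$. The parameters are called admissible if $\lambda_0,\ldots,\lambda_t$ are all integers. (A $t$-$(r,k,\lambda)_Q$ design is a set of $k$-dimensional subspaces, called blocks, of a polar space of type $Q$ and rank $r$ such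 that each $t$-dimensional subspace of the polar space is contained in exactly $\lambda$ of them; it has $\lambda_0$ blocks.) The reduced parameters of $t$-$(r,k,\lambda)_Q$ are $(t-1)$-$(r,k,\lambda_{t-1})_Q$. *)

theory Defs
  imports "HOL-Number_Theory.Prime_Powers" Complex_Main
begin

text \<open>
  The lower argument \<open>k\<close> is an integer, so that differences such as \<open>k - t\<close> may be
  negative; the coefficient is then 0.
\<close>
definition gauss_binomial :: "nat \<Rightarrow> nat \<Rightarrow> int \<Rightarrow> real" where
  "gauss_binomial q m k =
     (if 0 \<le> k \<and> k \<le> int m
      then (\<Prod>i\<in>{1..nat k}. (real q ^ (m - i + 1) - 1) / (real q ^ i - 1))
      else 0)"

text \<open>
  The types of finite classical polar spaces: symplectic, Hermitian in ambient dimension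
  \<open>2r\<close> and \<open>2r + 1\<close>, hyperbolic, parabolic and elliptic.
\<close>
datatype polar_type = Sp | U_plus | U_minus | Omega_plus | Omega | Omega_minus

fun epsilon :: "polar_type \<Rightarrow> real" where
  "epsilon Sp = 0"
| "epsilon U_plus = - 1 / 2"
| "epsilon U_minus = 1 / 2"
| "epsilon Omega_plus = - 1"
| "epsilon Omega = 0"
| "epsilon Omega_minus = 1"

text \<open>Hermitian polar spaces over the field of order \<open>q\<close> exist only if \<open>q\<close> is a square.\<close>
definition polar_type_over :: "nat \<Rightarrow> polar_type \<Rightarrow> bool" where
  "polar_type_over q Q \<longleftrightarrow> (Q \<in> {U_plus, U_minus} \<longrightarrow> (\<exists>s. q = s ^ 2))"

text \<open>
  The number of \<open>k\<close>-dimensional subspaces in a polar space of type \<open>Q\<close> and rank \<open>m\<close>;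
  for \<open>k = 1\<close> this is the number of points.
\<close>
definition polar_binomial :: "nat \<Rightarrow> polar_type \<Rightarrow> nat \<Rightarrow> int \<Rightarrow> real" where
  "polar_binomial q Q m k =
     (if 0 \<le> k \<and> k \<le> int m
      then gauss_binomial q m k *
           (\<Prod>i\<in>{m - nat k + 1..m}. (real q powr (real i + epsilon Q) + 1))
      else 0)"

definition lambda_max :: "nat \<Rightarrow> polar_type \<Rightarrow> nat \<Rightarrow> nat \<Rightarrow> nat \<Rightarrow> real" where
  "lambda_max q Q t r k = polar_binomial q Q (r - t) (int k - int t)"

text \<open>Only meaningful for \<open>s \<le> t \<le> k \<le> r\<close>.\<close>
definition lambda_s :: "nat \<Rightarrow> polar_type \<Rightarrow> nat \<Rightarrow> nat \<Rightarrow> nat \<Rightarrow> nat \<Rightarrow> nat \<Rightarrow> real" where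
  "lambda_s q Q t r k l s =
     real l * polar_binomial q Q (r - s) (int t - int s)
            / gauss_binomial q (k - s) (int t - int s)"

definition admissible :: "nat \<Rightarrow> polar_type \<Rightarrow> nat \<Rightarrow> nat \<Rightarrow> nat \<Rightarrow> nat \<Rightarrow> bool" where
  "admissible q Q t r k l \<longleftrightarrow> t \<le> k \<and> (\<forall>s\<in>{0..t}. lambda_s q Q t r k l s \<in> \<int>)"

text \<open>
  The tuple \<open>(t, r, k, l, Q)\<close> stands for the parameters \<open>t-(r, k, l)\<^sub>Q\<close>.
\<close>
definition admissible_params :: "nat \<Rightarrow> (nat \<times> nat \<times> nat \<times> nat \<times> polar_type) set" where
  "admissible_params q =
     {(t, r, k, l, Q). polar_type_over q Q \<and> 2 \<le> t \<and> t \<le> r \<and> k \<in> {0..r} \<and>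
        1 \<le> l \<and> real l \<le> lambda_max q Q t r k \<and> admissible q Q t r k l}"

text \<open>
  The fourth component is real because \<open>\<lambda>\<close> of the reduced parameters is given by a
  quotient, which is an integer only for admissible parameters.
\<close>
definition reduced_params ::
    "nat \<Rightarrow> nat \<times> nat \<times> nat \<times> nat \<times> polar_type \<Rightarrow> nat \<times> nat \<times> nat \<times> real \<times> polar_type" where
  "reduced_params q = (\<lambda>(t, r, k, l, Q). (t - 1, r, k, lambda_s q Q t r k l (t - 1), Q))"

end

theory Submission
  imports Defs
begin

text \<open>
  Dividing by the number of points compares \<open>\<lambda>\<^sub>0\<close> with a product of factors at least 1, two of
  which already rule out \<open>k < r\<close>. For \<open>k = r\<close> the Gaussian coefficients cancel: admissibility is
  automatic, and \<open>\<lambda>\<^sub>0\<close> is at most the number of points iff \<open>\<lambda>\<close> times the product of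
  \<open>q\<^sup>i\<^sup>+\<^sup>\<epsilon> + 1\<close> over \<open>r - t < i < r\<close> is at most \<open>q\<^sup>r\<^sup>-\<^sup>1 + \<dots> + q + 1\<close>. The product grows
  quickly with \<open>t\<close> and \<open>\<epsilon>\<close>, which leaves \<open>t = 2\<close> with \<open>\<epsilon> \<le> 0\<close> and the hyperbolic case
  \<open>t = 3\<close>, \<open>r \<le> 4\<close>.
\<close>

section \<open>Factors of the polar coefficients, type by type\<close>

definition polar_factor :: "nat \<Rightarrow> polar_type \<Rightarrow> nat \<Rightarrow> real" where
  "polar_factor q Q i = real q powr (real i + epsilon Q) + 1"

lemma polar_factor_Sp: "0 < q \<Longrightarrow> polar_factor q Sp i = real q ^ i + 1"
  by (simp add: polar_factor_def powr_realpow)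

lemma polar_factor_Omega: "0 < q \<Longrightarrow> polar_factor q Omega i = real q ^ i + 1"
  by (simp add: polar_factor_def powr_realpow)

lemma polar_factor_Omega_minus: "0 < q \<Longrightarrow> polar_factor q Omega_minus i = real q ^ Suc i + 1"
  by (simp add: polar_factor_def powr_realpow[symmetric] add.commute del: power_Suc)

lemma polar_factor_Omega_plus: "0 < q \<Longrightarrow> polar_factor q Omega_plus (Suc i) = real q ^ i + 1"
  by (simp add: polar_factor_def powr_realpow)

text \<open>A base \<open>s ^ 2\<close> doubles the exponent, so a half-integral exponent becomes an
  integer. This rewrites the Hermitian factors as odd powers of \<open>s\<close> plus 1.\<close>

lemma powr_square:
  assumes "0 < s" "2 * a = real n"
  shows "real (s ^ 2) powr a = real s ^ n"
proof -
  have "real (s ^ 2) powr a = (real s powr 2) powr a"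
    using assms(1) powr_realpow[of "real s" 2] by simp
  also have "\<dots> = real s powr real n"
    using assms(2) by (simp add: powr_powr del: powr_numeral)
  finally show ?thesis
    using assms(1) by (simp add: powr_realpow)
qed

lemma polar_factor_U_plus: "0 < s \<Longrightarrow> polar_factor (s ^ 2) U_plus (Suc i) = real s ^ (2 * i + 1) + 1"
  unfolding polar_factor_def by (subst powr_square[where n = "2 * i + 1"]) auto

lemma polar_factor_U_minus: "0 < s \<Longrightarrow> polar_factor (s ^ 2) U_minus i = real s ^ (2 * i + 1) + 1"
  unfolding polar_factor_def by (subst powr_square[where n = "2 * i + 1"]) auto

lemma epsilon_ge: "- 1 \<le> epsilon Q"
  by (cases Q) auto

text \<open>The exponent is smallest for \<open>epsilon Q = - 1\<close>, so the hyperbolic factor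
  bounds those of all types from below.\<close>

lemma polar_factor_ge:
  assumes "1 < q"
  shows "real q ^ i + 1 \<le> polar_factor q Q (Suc i)"
proof -
  have "real q powr real i \<le> real q powr (real (Suc i) + epsilon Q)"
    using assms epsilon_ge[of Q] by (intro powr_mono) auto
  then show ?thesis
    using assms by (simp add: polar_factor_def powr_realpow)
qed

lemma polar_factor_ge_2:
  assumes "1 < q" "1 \<le> i"
  shows "2 \<le> polar_factor q Q i"
proof -
  have "1 \<le> real q ^ (i - 1)"
    using assms by simp
  then show ?thesis
    using polar_factor_ge[OF assms(1), of "i - 1" Q] assms(2) by simp
qed

lemma polar_factor_pos: "0 < polar_factor q Q i"
  unfolding polar_factor_def by (rule add_nonneg_pos) auto

text \<open>Supplies the integrality behind admissibility. Index 0 is left out because the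
  hyperbolic exponent would be -1 there; in the Hermitian cases the half-integral power of
  \<open>q\<close> is a power of its integer square root.\<close>

lemma polar_factor_Ints:
  assumes "1 < q" "1 \<le> i" "polar_type_over q Q"
  shows "polar_factor q Q i \<in> \<int>"
proof -
  obtain j where i: "i = Suc j"
    using assms(2) by (cases i) auto
  show ?thesis
  proof (cases "Q \<in> {U_plus, U_minus}")
    case True
    then obtain s where s: "q = s ^ 2"
      using assms(3) by (auto simp: polar_type_over_def)
    then have "0 < s"
      using assms(1) by (cases s) auto
    then show ?thesis
      using True s i polar_factor_U_plus[of s j] polar_factor_U_minus[of s i] by auto
  next
    case False
    then show ?thesis
      using assms(1) i
      by (cases Q) (auto simp: polar_factor_Sp polar_factor_Omega polar_factor_Omega_plus
        polar_factor_Omega_minus)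
  qed
qed

section \<open>Gaussian coefficients\<close>

lemma power_neq_1:
  assumes "1 < q" "1 \<le> n"
  shows "real q ^ n \<noteq> 1"
proof -
  have "1 < real q ^ n"
    using assms by (intro one_less_power) auto
  then show ?thesis
    by linarith
qed

lemma gauss_binomial_pos:
  assumes "1 < q" "0 \<le> k" "k \<le> int m"
  shows "0 < gauss_binomial q m k"
  unfolding gauss_binomial_def using assms
  by (auto intro!: prod_pos divide_pos_pos simp del: power_Suc)

lemma gauss_binomial_1:
  assumes "1 < q" "1 \<le> m"
  shows "gauss_binomial q m 1 = (\<Sum>i<m. real q ^ i)"
  using assms by (simp add: gauss_binomial_def geometric_sum)

lemma gauss_binomial_self:
  assumes "1 < q"
  shows "gauss_binomial q m (int m) = 1"
proof -
  \<comment> \<open>The numerators are the denominators in reverse order.\<close>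
  have "(\<Prod>i\<in>{1..m}. real q ^ (m - i + 1) - 1) = (\<Prod>i\<in>{1..m}. real q ^ i - 1)"
    by (rule prod.reindex_bij_witness[where i = "\<lambda>i. m - i + 1" and j = "\<lambda>i. m - i + 1"]) auto
  moreover have "(\<Prod>i\<in>{1..m}. real q ^ i - 1) \<noteq> 0"
    using assms power_neq_1 by simp
  ultimately show ?thesis
    by (simp add: gauss_binomial_def prod_dividef)
qed

text \<open>The denominators \<open>q ^ i - 1\<close> are the same for both upper indices and
  cancel. Since \<open>k \<le> r\<close>, each remaining quotient is at least 1, which is what the
  later estimate exploits.\<close>

lemma gauss_binomial_ratio:
  assumes "1 < q" "t \<le> k" "k \<le> r"
  shows "gauss_binomial q r (int t) / gauss_binomial q k (int t) =
           (\<Prod>i\<in>{1..t}. (real q ^ (r - i + 1) - 1) / (real q ^ (k - i + 1) - 1))"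
proof -
  have "(\<Prod>i\<in>{1..t}. real q ^ i - 1) \<noteq> 0"
    using assms(1) power_neq_1 by simp
  then show ?thesis
    using assms by (simp add: gauss_binomial_def prod_dividef)
qed

section \<open>Polar coefficients and the parameters with \<open>k = r\<close>\<close>

lemma polar_binomial_eq:
  assumes "k \<le> m"
  shows "polar_binomial q Q m (int k) =
           gauss_binomial q m (int k) * (\<Prod>i\<in>{m - k + 1..m}. polar_factor q Q i)"
  using assms by (simp add: polar_binomial_def polar_factor_def)

lemma polar_binomial_1:
  assumes "1 < q" "1 \<le> r"
  shows "polar_binomial q Q r 1 = (\<Sum>i<r. real q ^ i) * polar_factor q Q r"
  using polar_binomial_eq[of 1 r q Q] assms gauss_binomial_1[of q r] by simp

lemma lambda_max_generators:
  assumes "1 < q" "t \<le> r"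
  shows "lambda_max q Q t r r = (\<Prod>i\<in>{1..r - t}. polar_factor q Q i)"
  using polar_binomial_eq[of "r - t" "r - t" q Q] assms gauss_binomial_self[of q "r - t"]
  by (simp add: lambda_max_def of_nat_diff)

text \<open>For \<open>k = r\<close> the same Gaussian coefficient stands in the numerator and in
  the denominator. The lower end \<open>r - t + 1\<close> of the remaining product does not depend
  on \<open>s\<close>.\<close>

lemma lambda_s_generators:
  assumes "1 < q" "s \<le> t" "t \<le> r"
  shows "lambda_s q Q t r r l s = real l * (\<Prod>i\<in>{r - t + 1..r - s}. polar_factor q Q i)"
proof -
  have "gauss_binomial q (r - s) (int (t - s)) > 0"
    using assms by (intro gauss_binomial_pos) auto
  moreover have "r - s - (t - s) = r - t"
    using assms by simp
  ultimately show ?thesis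
    using polar_binomial_eq[of "t - s" "r - s" q Q] assms
    by (simp add: lambda_s_def of_nat_diff)
qed

text \<open>Every \<open>lambda_s\<close> is \<open>l\<close> times a product of integers, so
  admissibility is automatic and only the ranges of the parameters remain.\<close>

lemma admissible_params_generators:
  assumes "1 < q"
  shows "(t, r, r, l, Q) \<in> admissible_params q \<longleftrightarrow>
           polar_type_over q Q \<and> 2 \<le> t \<and> t \<le> r \<and> 1 \<le> l \<and>
           real l \<le> (\<Prod>i\<in>{1..r - t}. polar_factor q Q i)"
  using assms
  by (auto simp: admissible_params_def admissible_def lambda_max_generators lambda_s_generators
    intro!: Ints_mult Ints_prod polar_factor_Ints)

section \<open>Few blocks force \<open>k = r\<close>\<close>

lemma sum_powers_le:
  fixes x :: real
  assumes "2 \<le> x"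
  shows "(\<Sum>i<n. x ^ i) \<le> x ^ n - 1"
proof -
  have "(x - 1) * (\<Sum>i<n. x ^ i) = x ^ n - 1"
    by (simp add: power_diff_1_eq)
  moreover have "1 * (\<Sum>i<n. x ^ i) \<le> (x - 1) * (\<Sum>i<n. x ^ i)"
    using assms by (intro mult_right_mono sum_nonneg) auto
  ultimately show ?thesis
    by simp
qed

text \<open>All factors of \<open>\<lambda>\<^sub>0\<close> are at least 1, and for \<open>k < r\<close> the first two of each kind
  already exceed the number of points.\<close>
lemma few_blocks_imp_generators:
  assumes q: "1 < q" and "2 \<le> t" "t \<le> k" "k \<le> r" "1 \<le> l"
    and le: "lambda_s q Q t r k l 0 \<le> polar_binomial q Q r 1"
  shows "k = r"
proof (rule ccontr)
  assume "k \<noteq> r"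
  then have "k < r"
    using assms by simp
  let ?x = "real q"
  let ?g = "\<lambda>i. (?x ^ (r - i + 1) - 1) / (?x ^ (k - i + 1) - 1)"
  let ?h = "polar_factor q Q"
  have x: "2 \<le> ?x"
    using q by simp
  have pos: "?x ^ k - 1 > 0" "?x ^ (k - 1) - 1 > 0"
    using assms by simp_all
  have g1: "1 \<le> ?g i" if "i \<in> {1..t}" for i
  proof -
    have "?x ^ (k - i + 1) \<le> ?x ^ (r - i + 1)"
      using assms by (intro power_increasing) auto
    moreover have "1 < ?x ^ (k - i + 1)"
      using q by (intro one_less_power) auto
    ultimately show ?thesis
      by (simp add: divide_simps)
  qed
  have h1: "1 \<le> ?h i" if "1 \<le> i" for i
    using polar_factor_ge_2[OF q that, of Q] by simp
  \<comment> \<open>As \<open>t \<ge> 2\<close>, two factors of each kind are available: the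
    quotients with \<open>i = 1\<close> and \<open>i = 2\<close> here, and the polar factors with
    the indices \<open>r - 1\<close> and \<open>r\<close> below.\<close>
  have "prod ?g {1, 2} \<le> prod ?g {1..t}"
    using assms g1 by (intro prod_mono2) (auto intro: order_trans[OF zero_le_one])
  moreover have "?g 2 = (?x ^ (r - 1) - 1) / (?x ^ (k - 1) - 1)"
  proof -
    have "r - 2 + 1 = r - 1" "k - 2 + 1 = k - 1"
      using assms by auto
    then show ?thesis by simp
  qed
  moreover have "?g 1 = (?x ^ r - 1) / (?x ^ k - 1)"
  proof -
    have "r - 1 + 1 = r" "k - 1 + 1 = k"
      using assms by auto
    then show ?thesis by simp
  qed
  moreover have "prod ?g {1, 2} = ?g 1 * ?g 2"
    by simp
  ultimately have g: "(?x ^ r - 1) / (?x ^ k - 1) * ((?x ^ (r - 1) - 1) / (?x ^ (k - 1) - 1))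
      \<le> prod ?g {1..t}" (is "?G \<le> _")
    by (simp only:)
  have "prod ?h {r - 1, r} \<le> prod ?h {r - t + 1..r}"
    using assms h1 by (intro prod_mono2) (auto intro: less_imp_le[OF polar_factor_pos])
  then have h: "?h (r - 1) * ?h r \<le> prod ?h {r - t + 1..r}"
    using assms \<open>k < r\<close> by (subst (asm) prod.insert) auto
  have G0: "0 < ?G"
    using assms pos \<open>k < r\<close> by (intro mult_pos_pos divide_pos_pos) auto
  have "?G * (?h (r - 1) * ?h r) \<le> prod ?g {1..t} * prod ?h {r - t + 1..r}"
    using g h G0 polar_factor_pos[of q Q] by (intro mult_mono) (auto intro: less_imp_le)
  also have "\<dots> \<le> real l * (prod ?g {1..t} * prod ?h {r - t + 1..r})"
  proof -
    have "0 \<le> prod ?g {1..t} * prod ?h {r - t + 1..r}"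
      by (intro mult_nonneg_nonneg less_imp_le[OF less_le_trans[OF G0 g]] prod_nonneg ballI
        less_imp_le[OF polar_factor_pos])
    from mult_right_mono[OF _ this, of 1 "real l"] show ?thesis
      using \<open>1 \<le> l\<close> by simp
  qed
  also have "\<dots> = lambda_s q Q t r k l 0"
    unfolding gauss_binomial_ratio[OF q assms(3,4), symmetric] using assms(3,4)
    by (simp add: lambda_s_def polar_binomial_eq)
  also have "\<dots> \<le> (\<Sum>i<r. ?x ^ i) * ?h r"
    using le polar_binomial_1[of q r Q] assms by simp
  finally have "?G * ?h (r - 1) * ?h r \<le> (\<Sum>i<r. ?x ^ i) * ?h r"
    by (simp only: mult.assoc)
  \<comment> \<open>The polar factor with index \<open>r\<close> also divides the number of
    points.\<close>
  then have "?G * ?h (r - 1) \<le> (\<Sum>i<r. ?x ^ i)"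
    by (rule mult_right_le_imp_le[OF _ polar_factor_pos])
  also have "\<dots> = (?x ^ r - 1) / (?x - 1)"
    using q by (simp add: geometric_sum)
  finally have "?G * ?h (r - 1) \<le> (?x ^ r - 1) / (?x - 1)" .
  \<comment> \<open>Clearing denominators exposes the common factor \<open>?x ^ r - 1\<close>; the
    quotient of \<open>?x ^ k - 1\<close> by \<open>?x - 1\<close> turns into the sum on the
    right.\<close>
  then have "(?x ^ r - 1) * ((?x ^ (r - 1) - 1) * ?h (r - 1))
      \<le> (?x ^ r - 1) * ((\<Sum>i<k. ?x ^ i) * (?x ^ (k - 1) - 1))"
  proof -
    have "a * (b * h) \<le> a * (c / e * d)"
      if "0 < c" "0 < d" "0 < e" "a / c * (b / d) * h \<le> a / e" for a b c d e h :: real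
      using that by (simp add: field_simps)
    from this[OF pos, of "?x - 1"] show ?thesis
      using \<open>?G * ?h (r - 1) \<le> (?x ^ r - 1) / (?x - 1)\<close> q by (simp add: geometric_sum)
  qed
  moreover have "0 < ?x ^ r - 1"
    using q assms by simp
  ultimately have 1: "(?x ^ (r - 1) - 1) * ?h (r - 1) \<le> (\<Sum>i<k. ?x ^ i) * (?x ^ (k - 1) - 1)"
    by simp
  \<comment> \<open>This is where \<open>k < r\<close> enters; it makes
    \<open>?x ^ (r - 1) - 1\<close> the next factor to cancel.\<close>
  have "(\<Sum>i<k. ?x ^ i) \<le> ?x ^ (r - 1) - 1"
  proof -
    have "?x ^ k \<le> ?x ^ (r - 1)"
      using q \<open>k < r\<close> by (intro power_increasing) auto
    then show ?thesis
      using sum_powers_le[OF x, of k] by linarith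
  qed
  then have "(\<Sum>i<k. ?x ^ i) * (?x ^ (k - 1) - 1) \<le> (?x ^ (r - 1) - 1) * (?x ^ (k - 1) - 1)"
    using pos by (intro mult_right_mono) auto
  with 1 have "(?x ^ (r - 1) - 1) * ?h (r - 1) \<le> (?x ^ (r - 1) - 1) * (?x ^ (k - 1) - 1)"
    by simp
  moreover have "0 < ?x ^ (r - 1) - 1"
    using q assms by simp
  ultimately have "?h (r - 1) \<le> ?x ^ (k - 1) - 1"
    by simp
  \<comment> \<open>The surviving inequality fails: its left side exceeds
    \<open>?x ^ (r - 2)\<close>, while its right side is smaller, because
    \<open>k - 1 \<le> r - 2\<close>.\<close>
  moreover have "?x ^ (r - 2) + 1 \<le> ?h (r - 1)"
  proof -
    have "Suc (r - 2) = r - 1"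
      using assms by simp
    then show ?thesis
      using polar_factor_ge[OF q, of "r - 2" Q] by simp
  qed
  moreover have "?x ^ (k - 1) \<le> ?x ^ (r - 2)"
    using q assms \<open>k < r\<close> by (intro power_increasing) auto
  ultimately show False
    by simp
qed

section \<open>The block inequality for \<open>k = r\<close>\<close>

text \<open>Both counts contain the positive factor with index \<open>r\<close>. Cancelling it
  leaves \<open>t - 1\<close> polar factors against a sum that no longer depends on the
  type.\<close>

lemma blocks_points_generators:
  assumes "1 < q" "2 \<le> t" "t \<le> r"
  shows "lambda_s q Q t r r l 0 \<le> polar_binomial q Q r 1 \<longleftrightarrow>
           real l * (\<Prod>i\<in>{r - t + 1..r - 1}. polar_factor q Q i) \<le> (\<Sum>i<r. real q ^ i)"
    and "lambda_s q Q t r r l 0 = polar_binomial q Q r 1 \<longleftrightarrow>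
           real l * (\<Prod>i\<in>{r - t + 1..r - 1}. polar_factor q Q i) = (\<Sum>i<r. real q ^ i)"
proof -
  have "{r - t + 1..r} = insert r {r - t + 1..r - 1}"
    using assms by auto
  moreover have "r \<notin> {r - t + 1..r - 1}"
    using assms by auto
  ultimately have "(\<Prod>i\<in>{r - t + 1..r}. polar_factor q Q i) =
      polar_factor q Q r * (\<Prod>i\<in>{r - t + 1..r - 1}. polar_factor q Q i)"
    by (metis prod.insert finite_atLeastAtMost)
  then have "lambda_s q Q t r r l 0 =
      (real l * (\<Prod>i\<in>{r - t + 1..r - 1}. polar_factor q Q i)) * polar_factor q Q r"
    using assms lambda_s_generators[of q 0 t r Q l] by simp
  moreover have "polar_binomial q Q r 1 = (\<Sum>i<r. real q ^ i) * polar_factor q Q r"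
    using assms by (intro polar_binomial_1) auto
  ultimately show "lambda_s q Q t r r l 0 \<le> polar_binomial q Q r 1 \<longleftrightarrow>
        real l * (\<Prod>i\<in>{r - t + 1..r - 1}. polar_factor q Q i) \<le> (\<Sum>i<r. real q ^ i)"
    and "lambda_s q Q t r r l 0 = polar_binomial q Q r 1 \<longleftrightarrow>
        real l * (\<Prod>i\<in>{r - t + 1..r - 1}. polar_factor q Q i) = (\<Sum>i<r. real q ^ i)"
    using polar_factor_pos[of q Q r] by simp_all
qed

lemma prod_polar_factor_ge:
  assumes "1 < q" "A \<subseteq> {1..n}" "B \<subseteq> A"
  shows "(\<Prod>i\<in>B. polar_factor q Q i) \<le> (\<Prod>i\<in>A. polar_factor q Q i)"
proof (rule prod_mono2)
  show "1 \<le> polar_factor q Q i" if "i \<in> A - B" for i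
    using that assms polar_factor_ge_2[of q i Q] by fastforce
qed (use assms in \<open>auto intro: finite_subset less_imp_le[OF polar_factor_pos]\<close>)

lemma prod_polar_factor_ge_1:
  assumes "1 < q"
  shows "1 \<le> (\<Prod>i\<in>{1..n}. polar_factor q Q i)"
  using prod_polar_factor_ge[OF assms, of "{1..n}" n "{}" Q] by simp

text \<open>Serves to show that there are too many blocks by looking only at a few chosen factors,
  mostly those of largest index.\<close>

lemma scaled_prod_ge:
  assumes "1 < q" "t \<le> r" "1 \<le> l" "B \<subseteq> {r - t + 1..r - 1}"
  shows "(\<Prod>i\<in>B. polar_factor q Q i) \<le> real l * (\<Prod>i\<in>{r - t + 1..r - 1}. polar_factor q Q i)"
proof -
  let ?P = "\<Prod>i\<in>{r - t + 1..r - 1}. polar_factor q Q i"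
  have "(\<Prod>i\<in>B. polar_factor q Q i) \<le> ?P"
    using assms by (intro prod_polar_factor_ge[where n = r]) auto
  also have "1 * ?P \<le> real l * ?P"
    using assms by (intro mult_right_mono prod_nonneg) (auto intro: less_imp_le[OF polar_factor_pos])
  finally show ?thesis
    by simp
qed

section \<open>The block inequality for each type\<close>

text \<open>Put \<open>m = r - 1\<close>. The sum is \<open>q ^ m\<close> plus lower powers, whose
  total lies between 1 and \<open>q ^ m - 1\<close>. A single factor \<open>q ^ m + 1\<close>
  therefore fits, but twice that is too much, whether the doubling comes from
  \<open>l \<ge> 2\<close> or from a further factor. Equality means that the lower powers add up to
  1, that is \<open>m = 1\<close>.\<close>

lemma few_generators_epsilon_0:
  assumes q: "1 < q" and "2 \<le> t" "t \<le> r" "1 \<le> l" and Q: "Q \<in> {Omega, Sp}"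
  defines "L \<equiv> real l * (\<Prod>i\<in>{r - t + 1..r - 1}. polar_factor q Q i)"
  shows "L \<le> (\<Sum>i<r. real q ^ i) \<longleftrightarrow> t = 2 \<and> l = 1"
    and "L = (\<Sum>i<r. real q ^ i) \<longleftrightarrow> t = 2 \<and> l = 1 \<and> r = 2"
proof -
  define m where "m = r - 1"
  have r: "r = Suc m" "1 \<le> m"
    using assms by (auto simp: m_def)
  let ?x = "real q" and ?S = "\<Sum>i<m. real q ^ i"
  have S: "(\<Sum>i<r. ?x ^ i) = ?x ^ m + ?S" "?S \<le> ?x ^ m - 1"
    using q sum_powers_le[of ?x m] by (auto simp: r)
  have h: "polar_factor q Q i = ?x ^ i + 1" for i
    using Q q by (auto simp: polar_factor_Sp polar_factor_Omega)
  have t2: "L = real l * (?x ^ m + 1)" if "t = 2"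
    using that r by (simp add: L_def h Suc_diff_le numeral_2_eq_2)
  have S1: "1 \<le> ?S" "?S = 1 \<longleftrightarrow> m = 1"
  proof -
    obtain n where n: "m = Suc n"
      using r(2) by (cases m) auto
    define T where "T = ?x * (\<Sum>i<n. ?x ^ i)"
    have "?S = 1 + T"
      unfolding n T_def by (subst sum.lessThan_Suc_shift) (simp add: sum_distrib_left)
    moreover have "0 < T" if "n \<noteq> 0"
      unfolding T_def using that q by (intro mult_pos_pos sum_pos) auto
    moreover have "T = 0" if "n = 0"
      using that by (simp add: T_def)
    ultimately show "1 \<le> ?S" "?S = 1 \<longleftrightarrow> m = 1"
      using n by (cases "n = 0"; simp)+
  qed
  have big: "?x ^ m + ?S < L" if "\<not> (t = 2 \<and> l = 1)"
  proof -
    have "2 * (?x ^ m + 1) \<le> L"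
    proof (cases "t = 2")
      case True
      then have "2 \<le> real l"
        using that \<open>1 \<le> l\<close> by simp
      then show ?thesis
        unfolding t2[OF True] using q by (intro mult_right_mono) auto
    next
      case False
      \<comment> \<open>From \<open>t \<ge> 3\<close> on, the index \<open>m - 1 = r - 2\<close>
        lies in the range too.\<close>
      then have "{m - 1, m} \<subseteq> {r - t + 1..r - 1}"
        using assms r by auto
      from scaled_prod_ge[OF q _ _ this, of l Q]
      have "polar_factor q Q (m - 1) * polar_factor q Q m \<le> L"
        using assms r by (simp add: L_def)
      moreover have "2 * (?x ^ m + 1) \<le> (?x ^ (m - 1) + 1) * (?x ^ m + 1)"
        using q by (intro mult_right_mono) auto
      ultimately show ?thesis
        by (simp add: h)
    qed
    then show ?thesis
      using S(2) by simp
  qed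
  show "L \<le> (\<Sum>i<r. ?x ^ i) \<longleftrightarrow> t = 2 \<and> l = 1"
    and "L = (\<Sum>i<r. ?x ^ i) \<longleftrightarrow> t = 2 \<and> l = 1 \<and> r = 2"
    using S S1 big t2 r by (cases "t = 2 \<and> l = 1"; auto)+
qed

text \<open>Multiplying the sum by \<open>s ^ 2 - 1\<close> gives \<open>s ^ (2 * n) - 1\<close>,
  and \<open>s ^ 2 - 1 \<ge> s\<close>. The bound is an odd power of \<open>s\<close> to match the
  Hermitian factors.\<close>

lemma sum_even_powers_less:
  assumes "1 < s" "1 \<le> n"
  shows "(\<Sum>i<n. real (s ^ 2) ^ i) < real s ^ (2 * n - 1)"
proof -
  let ?y = "real s" and ?S = "\<Sum>i<n. real (s ^ 2) ^ i"
  have y: "2 \<le> ?y"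
    using assms by simp
  have "(?y ^ 2 - 1) * ?S = ?y ^ (2 * n) - 1"
    using power_diff_1_eq[of "?y ^ 2" n] by (simp add: power_mult)
  moreover have "?y * ?S \<le> (?y ^ 2 - 1) * ?S"
  proof (rule mult_right_mono)
    have "2 * ?y \<le> ?y ^ 2"
      using y by (simp add: power2_eq_square)
    then show "?y \<le> ?y ^ 2 - 1"
      using y by linarith
  qed (auto intro: sum_nonneg)
  moreover have "?y ^ (2 * n) = ?y * ?y ^ (2 * n - 1)"
    using assms(2) by (cases n) auto
  ultimately have "?y * ?S < ?y * ?y ^ (2 * n - 1)"
    by simp
  then show ?thesis
    using y by simp
qed

text \<open>The factor with index \<open>r - 1\<close> alone is too large: it is
  \<open>q ^ r + 1\<close> in the elliptic case and \<open>s ^ (2 * r - 1) + 1\<close>, where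
  \<open>q = s ^ 2\<close>, in the Hermitian case.\<close>

lemma many_generators_minus:
  assumes q: "1 < q" and "2 \<le> t" "t \<le> r" "1 \<le> l" and Q: "Q \<in> {U_minus, Omega_minus}"
    and over: "polar_type_over q Q"
  shows "(\<Sum>i<r. real q ^ i) < real l * (\<Prod>i\<in>{r - t + 1..r - 1}. polar_factor q Q i)"
proof -
  let ?x = "real q"
  have "(\<Sum>i<r. ?x ^ i) < polar_factor q Q (r - 1)"
  proof (cases "Q = Omega_minus")
    case True
    then show ?thesis
      using sum_powers_le[of ?x r] assms by (simp add: polar_factor_Omega_minus)
  next
    case False
    then have U: "Q = U_minus"
      using Q by simp
    then obtain s where s: "q = s ^ 2"
      using over by (auto simp: polar_type_over_def)
    then have "1 < s"
      using q by (cases "s = 0"; cases "s = 1") auto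
    moreover have "2 * (r - 1) + 1 = 2 * r - 1"
      using assms by simp
    ultimately show ?thesis
      using sum_even_powers_less[of s r] assms
      by (simp add: U s polar_factor_U_minus del: of_nat_power)
  qed
  also have "\<dots> \<le> real l * (\<Prod>i\<in>{r - t + 1..r - 1}. polar_factor q Q i)"
    using scaled_prod_ge[OF q, of t r l "{r - 1}" Q] assms by auto
  finally show ?thesis .
qed

text \<open>Put \<open>m = r - 2\<close>. For \<open>t = 2\<close> the left side is
  \<open>l * (s ^ (2 * m + 1) + 1)\<close>, and the sum is \<open>s ^ (2 * m + 2)\<close> plus a
  remainder below \<open>s ^ (2 * m + 1)\<close>. So \<open>l = s + 1\<close> overshoots, while
  \<open>l = s\<close> fits as soon as the remainder exceeds \<open>s\<close>, which holds for
  \<open>r \<ge> 3\<close>. All comparisons are strict, which excludes equality.\<close>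

lemma few_generators_U_plus:
  assumes s: "1 < s" "q = s ^ 2" and "2 \<le> t" "t \<le> r" "1 \<le> l"
    and max: "real l \<le> (\<Prod>i\<in>{1..r - t}. polar_factor q U_plus i)"
  defines "L \<equiv> real l * (\<Prod>i\<in>{r - t + 1..r - 1}. polar_factor q U_plus i)"
  shows "L \<le> (\<Sum>i<r. real q ^ i) \<longleftrightarrow> t = 2 \<and> (r = 2 \<or> l \<le> s)"
    and "L \<noteq> (\<Sum>i<r. real q ^ i)"
proof -
  have q: "1 < q"
    using s one_less_power[of s 2] by simp
  define m where "m = r - 2"
  have r: "r = Suc (Suc m)"
    using assms by (simp add: m_def)
  let ?y = "real s" and ?S = "\<Sum>i<Suc m. real q ^ i"
  have y: "2 \<le> ?y"
    using s by simp
  have S: "(\<Sum>i<r. real q ^ i) = ?y ^ (2 * m + 2) + ?S" "?S < ?y ^ (2 * m + 1)"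
    using sum_even_powers_less[of s "Suc m"] s
    by (auto simp: r power_mult power2_eq_square)
  have h: "polar_factor q U_plus (Suc i) = ?y ^ (2 * i + 1) + 1" for i
    using s polar_factor_U_plus[of s i] by simp
  have t2: "L = real l * (?y ^ (2 * m + 1) + 1)" if "t = 2"
    using that by (simp add: L_def r h numeral_2_eq_2)
  have small: "L < ?y ^ (2 * m + 2) + ?S" if "t = 2" "r = 2 \<or> l \<le> s"
  proof (cases "r = 2")
    case True
    \<comment> \<open>With \<open>t = r = 2\<close> the product in \<open>max\<close> is
      empty.\<close>
    then have "l = 1"
      using max assms that by simp
    moreover have "?y < ?y ^ 2"
      using s by (simp add: power2_eq_square)
    ultimately show ?thesis
      using True r t2[OF that(1)] by (simp add: power2_eq_square)
  next
    case False
    then obtain n where n: "m = Suc n"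
      using r by (cases m) auto
    have "L \<le> ?y * (?y ^ (2 * m + 1) + 1)"
      unfolding t2[OF that(1)] using that False by (intro mult_right_mono) auto
    also have "\<dots> = ?y ^ (2 * m + 2) + ?y"
      by (simp add: algebra_simps)
    finally have "L \<le> ?y ^ (2 * m + 2) + ?y" .
    moreover have "?y < ?S"
    proof -
      have "?y < real q ^ 1"
        using s by (simp add: power2_eq_square)
      also have "\<dots> \<le> real q ^ m"
        using q n by (intro power_increasing) auto
      also have "\<dots> \<le> ?S"
        by (simp add: sum_nonneg)
      finally show ?thesis .
    qed
    ultimately show ?thesis
      by linarith
  qed
  have big: "?y ^ (2 * m + 2) + ?S < L" if "\<not> (t = 2 \<and> (r = 2 \<or> l \<le> s))"
  proof -
    \<comment> \<open>This bound beats the sum since \<open>?S < ?y ^ (2 * m + 1)\<close>. It is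
      reached by \<open>l \<ge> s + 1\<close> if \<open>t = 2\<close>, and by the two largest
      factors if \<open>t \<ge> 3\<close>.\<close>
    have "?y ^ (2 * m + 2) + ?y ^ (2 * m + 1) \<le> L"
    proof (cases "t = 2")
      case True
      then have "?y + 1 \<le> real l"
        using that by simp
      then have "(?y + 1) * (?y ^ (2 * m + 1) + 1) \<le> L"
        unfolding t2[OF True] using y by (intro mult_right_mono) auto
      then show ?thesis
        using y by (simp add: algebra_simps)
    next
      case False
      then obtain n where n: "m = Suc n"
        using assms r by (cases m) auto
      have "polar_factor q U_plus (Suc n) * polar_factor q U_plus (Suc m) \<le> L"
        using scaled_prod_ge[OF q, of t r l "{Suc n, Suc m}" U_plus] assms False
        by (auto simp: L_def r n)
      moreover have "?y ^ (2 * m + 2) \<le> ?y ^ (2 * n + 1) * ?y ^ (2 * m + 1)"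
        unfolding power_add[symmetric] using s n by (intro power_increasing) auto
      moreover have "0 \<le> ?y ^ (2 * n + 1)"
        by simp
      ultimately show ?thesis
        unfolding h by (simp only: distrib_left distrib_right mult_1_left mult_1_right)
    qed
    then show ?thesis
      using S(2) by simp
  qed
  show "L \<le> (\<Sum>i<r. real q ^ i) \<longleftrightarrow> t = 2 \<and> (r = 2 \<or> l \<le> s)"
    and "L \<noteq> (\<Sum>i<r. real q ^ i)"
    unfolding S(1) using small big by (cases "t = 2 \<and> (r = 2 \<or> l \<le> s)"; force)+
qed

text \<open>Put \<open>m = r - 2\<close>. For \<open>t = 2\<close> and \<open>l = q + 1\<close> the
  left side is \<open>q ^ (m + 1) + q ^ m + q + 1\<close>, which for \<open>m \<ge> 2\<close>
  consists of terms of the sum, and of all of them iff \<open>m = 2\<close>. For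
  \<open>t = 3\<close> and \<open>r = 4\<close> the factors \<open>q + 1\<close> and
  \<open>q ^ 2 + 1\<close> multiply to exactly the sum.\<close>

lemma few_generators_Omega_plus:
  assumes q: "1 < q" and "2 \<le> t" "t \<le> r" "1 \<le> l"
    and max: "real l \<le> (\<Prod>i\<in>{1..r - t}. polar_factor q Omega_plus i)"
  defines "L \<equiv> real l * (\<Prod>i\<in>{r - t + 1..r - 1}. polar_factor q Omega_plus i)"
  shows "L \<le> (\<Sum>i<r. real q ^ i) \<longleftrightarrow>
           t = 2 \<and> (r \<le> 3 \<or> l \<le> q + 1) \<or> t = 3 \<and> l = 1 \<and> r \<le> 4"
    and "L = (\<Sum>i<r. real q ^ i) \<longleftrightarrow>
           t = 2 \<and> r = 4 \<and> l = q + 1 \<or> t = 3 \<and> r = 4 \<and> l = 1"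
proof -
  define m where "m = r - 2"
  have r: "r = Suc (Suc m)"
    using assms by (simp add: m_def)
  let ?x = "real q" and ?S = "\<Sum>i<m. real q ^ i"
  let ?N = "\<Sum>i<r. real q ^ i"
  have x: "2 \<le> ?x"
    using q by simp
  \<comment> \<open>Settles \<open>r = 3\<close>: the 2 bounds \<open>l\<close> if
    \<open>t = 2\<close>, and is the factor with index 1 if \<open>t = 3\<close>.\<close>
  have xx: "2 * (?x + 1) < ?x ^ 2 + ?x + 1"
  proof -
    have "1 * 2 \<le> (?x - 1) * ?x"
      using x by (intro mult_mono) auto
    then show ?thesis
      by (simp add: power2_eq_square algebra_simps)
  qed
  have S: "?N = ?x ^ Suc m + ?x ^ m + ?S" "?S \<le> ?x ^ m - 1"
    using sum_powers_le[OF x, of m] by (auto simp: r)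
  have h: "polar_factor q Omega_plus (Suc i) = ?x ^ i + 1" for i
    using q polar_factor_Omega_plus[of q i] by simp
  have t2: "L = real l * (?x ^ m + 1)" if "t = 2"
    using that by (simp add: L_def r h numeral_2_eq_2)
  have t3: "L = real l * ((?x ^ n + 1) * (?x ^ m + 1))" if "t = 3" "m = Suc n" for n
  proof -
    have "{r - t + 1..r - 1} = {Suc n, Suc m}"
      using that by (auto simp: r)
    then show ?thesis
      by (simp add: L_def h that)
  qed
  have t2_le: "L < ?N" if "t = 2" "r \<le> 3 \<or> l \<le> q"
  proof -
    consider "m = 0" | "m = 1" | "2 \<le> m"
      by linarith
    then show ?thesis
    proof cases
      case 1
      then have "l = 1"
        using max assms that r by simp
      then show ?thesis
        using 1 q r t2[OF that(1)] by simp
    next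
      case 2
      then have "real l \<le> 2"
        using max that h[of 0] by (simp add: r)
      then have "L \<le> 2 * (?x ^ m + 1)"
        unfolding t2[OF that(1)] using x by (intro mult_right_mono) auto
      then have "L \<le> 2 * (?x + 1)"
        by (simp add: 2)
      moreover have "?N = ?x ^ 2 + ?x + 1"
        using S(1) by (simp add: 2 power2_eq_square)
      ultimately show ?thesis
        using xx by (simp only: order.strict_trans1)
    next
      case 3
      then have "L \<le> ?x * (?x ^ m + 1)"
        unfolding t2[OF that(1)] using that r by (intro mult_right_mono) auto
      also have "\<dots> = ?x ^ Suc m + ?x"
        by (simp add: algebra_simps)
      also have "\<dots> < ?x ^ Suc m + ?x ^ m"
        using power_strict_increasing[of 1 m ?x] 3 q by simp
      finally have "L < ?x ^ Suc m + ?x ^ m" .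
      moreover have "0 \<le> ?S"
        by (simp add: sum_nonneg)
      ultimately show ?thesis
        unfolding S(1) by linarith
    qed
  qed
  have t2_eq: "L \<le> ?N" "L = ?N \<longleftrightarrow> r = 4" if t: "t = 2" "4 \<le> r" "l = q + 1"
  proof -
    obtain n where n: "m = Suc (Suc n)"
      using t(2) r by (cases m; cases "m - 1") auto
    \<comment> \<open>Splitting off \<open>1 + ?x\<close> accounts for all of \<open>L\<close>; the
      rest is an empty sum iff \<open>m = 2\<close>.\<close>
    have "?S = 1 + ?x + (\<Sum>i<n. ?x ^ Suc (Suc i))"
      unfolding n by (subst sum.lessThan_Suc_shift, subst sum.lessThan_Suc_shift) simp
    then have "?N = L + (\<Sum>i<n. ?x ^ Suc (Suc i))"
      unfolding S(1) t2[OF t(1)] by (simp add: t(3) algebra_simps)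
    moreover have "0 < (\<Sum>i<n. ?x ^ Suc (Suc i))" if "n \<noteq> 0"
      using that q by (intro sum_pos) auto
    ultimately show "L \<le> ?N" "L = ?N \<longleftrightarrow> r = 4"
      by (cases "n = 0"; force simp: n r)+
  qed
  have t2_gt: "?N < L" if "t = 2" "q + 1 < l"
  proof -
    \<comment> \<open>With \<open>l \<ge> q + 2\<close> a second \<open>?x ^ m\<close> appears,
      which exceeds \<open>?S\<close>.\<close>
    have "(?x + 2) * (?x ^ m + 1) \<le> L"
      unfolding t2[OF that(1)] using that by (intro mult_right_mono) auto
    then show ?thesis
      using S x by (simp add: algebra_simps)
  qed
  have t3_3: "L < ?N" if "t = 3" "r = 3"
  proof -
    have "m = Suc 0" "l = 1"
      using that max \<open>1 \<le> l\<close> r by auto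
    then have "L = 2 * (?x + 1)" "?N = ?x ^ 2 + ?x + 1"
      using t3[OF that(1)] S(1) by (auto simp: power2_eq_square)
    then show ?thesis
      using xx by (simp only:)
  qed
  have t3_4: "L = real l * ?N" if "t = 3" "r = 4"
  proof -
    have "m = Suc 1"
      using that r by simp
    then show ?thesis
      using t3[OF that(1), of 1] S(1) by (simp add: algebra_simps)
  qed
  have N0: "0 < ?N"
    using q r by (intro sum_pos) auto
  have t4: "?N < L" if "4 \<le> t" "r = 4"
  proof -
    \<comment> \<open>Here \<open>t = r = 4\<close>. The additional factor with index 1 is
      \<open>q ^ 0 + 1 = 2\<close> and doubles the product that equals the sum.\<close>
    have "(\<Prod>i\<in>{1, 2, 3}. polar_factor q Omega_plus i) \<le> L"
      using scaled_prod_ge[OF q, of t r l "{1, 2, 3}" Omega_plus] assms that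
      by (auto simp: L_def)
    moreover have "(\<Prod>i\<in>{1, 2, 3}. polar_factor q Omega_plus i) = 2 * ?N"
      using h[of 0] h[of 1] h[of 2] that(2)
      by (simp add: numeral_2_eq_2 numeral_3_eq_3 eval_nat_numeral algebra_simps)
    ultimately show ?thesis
      using N0 by simp
  qed
  have t3_gt: "?N < L" if t: "3 \<le> t" "5 \<le> r"
  proof -
    obtain n where n: "m = Suc n"
      using t r by (cases m) auto
    have "polar_factor q Omega_plus (Suc n) * polar_factor q Omega_plus (Suc m) \<le> L"
      using scaled_prod_ge[OF q, of t r l "{Suc n, Suc m}" Omega_plus] assms that
      by (auto simp: L_def r n)
    then have "?x ^ n * ?x ^ m + ?x ^ n + ?x ^ m + 1 \<le> L"
      unfolding h by (simp add: algebra_simps)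
    \<comment> \<open>The exponent \<open>n + m = 2 * r - 5\<close> reaches \<open>r\<close> from
      \<open>r = 5\<close> on.\<close>
    moreover have "?x ^ r \<le> ?x ^ n * ?x ^ m"
      unfolding power_add[symmetric] using that r n q by (intro power_increasing) auto
    moreover have "0 < ?x ^ n" "0 < ?x ^ m"
      using q by auto
    ultimately show ?thesis
      using sum_powers_le[OF x, of r] by linarith
  qed
  consider "t = 2" "r \<le> 3 \<or> l \<le> q" | "t = 2" "4 \<le> r" "l = q + 1" | "t = 2" "4 \<le> r" "q + 1 < l"
    | "t = 3" "r = 3" | "t = 3" "r = 4" | "4 \<le> t" "r = 4" | "3 \<le> t" "5 \<le> r"
    using assms(2,3) by linarith
  then have "(L \<le> ?N \<longleftrightarrow> t = 2 \<and> (r \<le> 3 \<or> l \<le> q + 1) \<or> t = 3 \<and> l = 1 \<and> r \<le> 4) \<and>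
      (L = ?N \<longleftrightarrow> t = 2 \<and> r = 4 \<and> l = q + 1 \<or> t = 3 \<and> r = 4 \<and> l = 1)"
  proof cases
    case 1
    then show ?thesis using t2_le by auto
  next
    case 2
    then show ?thesis using t2_eq by auto
  next
    case 3
    then show ?thesis using t2_gt by auto
  next
    case 4
    then have "l = 1"
      using max \<open>1 \<le> l\<close> by simp
    then show ?thesis using 4 t3_3 by auto
  next
    case 5
    then have "L \<le> ?N \<longleftrightarrow> l = 1" "L = ?N \<longleftrightarrow> l = 1"
      using t3_4 N0 \<open>1 \<le> l\<close> by (auto simp: mult_le_cancel_right1)
    then show ?thesis using 5 by auto
  next
    case 6
    then show ?thesis using t4 by auto
  next
    case 7
    then show ?thesis using t3_gt by auto
  qed
  then show "L \<le> ?N \<longleftrightarrow> t = 2 \<and> (r \<le> 3 \<or> l \<le> q + 1) \<or> t = 3 \<and> l = 1 \<and> r \<le> 4"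
    and "L = ?N \<longleftrightarrow> t = 2 \<and> r = 4 \<and> l = q + 1 \<or> t = 3 \<and> r = 4 \<and> l = 1"
    by auto
qed

section \<open>From the inequality back to parameters\<close>

text \<open>Equality is a special case of \<open>\<le>\<close>, so \<open>k = r\<close> is forced in
  both statements, and the common factor can then be cancelled.\<close>

lemma few_blocks_iff:
  assumes q: "1 < q"
  shows "(t, r, k, l, Q) \<in> admissible_params q \<and> lambda_s q Q t r k l 0 \<le> polar_binomial q Q r 1
           \<longleftrightarrow> k = r \<and> (t, r, r, l, Q) \<in> admissible_params q \<and>
             real l * (\<Prod>i\<in>{r - t + 1..r - 1}. polar_factor q Q i) \<le> (\<Sum>i<r. real q ^ i)"
    (is "?few \<longleftrightarrow> ?few'")
    and "(t, r, k, l, Q) \<in> admissible_params q \<and> lambda_s q Q t r k l 0 = polar_binomial q Q r 1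
           \<longleftrightarrow> k = r \<and> (t, r, r, l, Q) \<in> admissible_params q \<and>
             real l * (\<Prod>i\<in>{r - t + 1..r - 1}. polar_factor q Q i) = (\<Sum>i<r. real q ^ i)"
    (is "?eq \<longleftrightarrow> ?eq'")
proof -
  have "k = r" if "(t, r, k, l, Q) \<in> admissible_params q"
    "lambda_s q Q t r k l 0 \<le> polar_binomial q Q r 1"
    using that few_blocks_imp_generators[OF q, of t k r l Q]
    by (auto simp: admissible_params_def admissible_def)
  moreover have "2 \<le> t \<and> t \<le> r" if "(t, r, r, l, Q) \<in> admissible_params q"
    using that by (auto simp: admissible_params_def)
  ultimately show "?few \<longleftrightarrow> ?few'" "?eq \<longleftrightarrow> ?eq'"
    using blocks_points_generators[OF q, of t r Q l] by (metis order_refl)+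
qed

lemma few_blocks_epsilon_0:
  assumes q: "1 < q" and Q: "Q \<in> {Omega, Sp}"
  shows "(t, r, k, l, Q) \<in> admissible_params q \<and> lambda_s q Q t r k l 0 \<le> polar_binomial q Q r 1
           \<longleftrightarrow> t = 2 \<and> k = r \<and> l = 1 \<and> 2 \<le> r"
    and "(t, r, k, l, Q) \<in> admissible_params q \<and> lambda_s q Q t r k l 0 = polar_binomial q Q r 1
           \<longleftrightarrow> t = 2 \<and> k = r \<and> l = 1 \<and> r = 2"
proof -
  have "polar_type_over q Q"
    using Q by (auto simp: polar_type_over_def)
  then show "(t, r, k, l, Q) \<in> admissible_params q \<and>
      lambda_s q Q t r k l 0 \<le> polar_binomial q Q r 1 \<longleftrightarrow> t = 2 \<and> k = r \<and> l = 1 \<and> 2 \<le> r"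
    and "(t, r, k, l, Q) \<in> admissible_params q \<and>
      lambda_s q Q t r k l 0 = polar_binomial q Q r 1 \<longleftrightarrow> t = 2 \<and> k = r \<and> l = 1 \<and> r = 2"
    unfolding few_blocks_iff[OF q] admissible_params_generators[OF q]
    using few_generators_epsilon_0[OF q _ _ _ Q, of t r l] prod_polar_factor_ge_1[OF q, of Q "r - t"]
    by auto
qed

lemma many_blocks_minus:
  assumes q: "1 < q" and Q: "Q \<in> {U_minus, Omega_minus}"
    and "(t, r, k, l, Q) \<in> admissible_params q"
  shows "polar_binomial q Q r 1 < lambda_s q Q t r k l 0"
proof (rule ccontr)
  assume "\<not> ?thesis"
  with assms(3) show False
    using few_blocks_iff(1)[OF q, of t r k l Q] admissible_params_generators[OF q, of t r l Q]
      many_generators_minus[OF q _ _ _ Q, of t r l] by auto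
qed

text \<open>If \<open>q = s ^ 2\<close>, then \<open>sqrt q = s\<close>, and for
  \<open>t = 2\<close>, \<open>r \<ge> 3\<close> the factor \<open>s + 1\<close> with index 1
  already keeps \<open>lambda_max\<close> above \<open>s\<close>. For \<open>r = 2\<close> the bound
  \<open>lambda_max = 1\<close> leaves only \<open>l = 1\<close>. If \<open>q\<close> is not a
  square, there are no such parameters.\<close>

lemma few_blocks_U_plus:
  assumes q: "1 < q"
  shows "(t, r, k, l, U_plus) \<in> admissible_params q \<and>
           lambda_s q U_plus t r k l 0 \<le> polar_binomial q U_plus r 1
           \<longleftrightarrow> t = 2 \<and> k = r \<and> polar_type_over q U_plus \<and>
             (r = 2 \<and> l = 1 \<or> 3 \<le> r \<and> 1 \<le> l \<and> real l \<le> sqrt (real q))" (is ?few)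
    and "\<not> ((t, r, k, l, U_plus) \<in> admissible_params q \<and>
           lambda_s q U_plus t r k l 0 = polar_binomial q U_plus r 1)" (is ?eq)
proof -
  have "?few \<and> ?eq"
  proof (cases "polar_type_over q U_plus")
    case False
    then show ?thesis
      by (auto simp: admissible_params_def)
  next
    case True
    then obtain s where s: "q = s ^ 2"
      by (auto simp: polar_type_over_def)
    then have s1: "1 < s"
      using q by (cases "s = 0"; cases "s = 1") auto
    have sqrt: "real l \<le> sqrt (real q) \<longleftrightarrow> l \<le> s"
      by (simp add: s)
    let ?M = "\<Prod>i\<in>{1..r - t}. polar_factor q U_plus i"
    have "real l \<le> ?M" if "t = 2" "3 \<le> r" "l \<le> s"
    proof -
      have "polar_factor q U_plus 1 \<le> ?M"
        using prod_polar_factor_ge[OF q, of "{1..r - t}" "r - t" "{1}" U_plus] that by auto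
      then show ?thesis
        using polar_factor_U_plus[of s 0] s s1 that by simp
    qed
    moreover have "real l \<le> ?M \<longleftrightarrow> l \<le> 1" if "r = t"
      using that by simp
    moreover have "real l \<le> ?M" if "l = 1"
      using prod_polar_factor_ge_1[OF q, of U_plus "r - t"] that by simp
    \<comment> \<open>With the bound, the product and the sum as atoms, the remaining case analysis
      is nearly propositional.\<close>
    moreover define M where "M \<longleftrightarrow> real l \<le> ?M"
    ultimately have M: "t = 2 \<Longrightarrow> 3 \<le> r \<Longrightarrow> l \<le> s \<Longrightarrow> M" "r = t \<Longrightarrow> M \<longleftrightarrow> l \<le> 1" "l = 1 \<Longrightarrow> M"
      by blast+
    have r: "r = 2 \<or> 3 \<le> r" if "2 \<le> r"
      using that by linarith
    define L where "L = real l * (\<Prod>i\<in>{r - t + 1..r - 1}. polar_factor q U_plus i)"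
    define S where "S = (\<Sum>i<r. real q ^ i)"
    note gen = few_generators_U_plus[OF s1 s, of t r l, folded M_def L_def S_def]
    have "(2 \<le> t \<and> t \<le> r \<and> 1 \<le> l \<and> M) \<and> L \<le> S \<longleftrightarrow>
        t = 2 \<and> (r = 2 \<and> l = 1 \<or> 3 \<le> r \<and> 1 \<le> l \<and> l \<le> s)"
      using gen(1) M s1 r by auto
    then show ?thesis
      unfolding few_blocks_iff[OF q] admissible_params_generators[OF q] sqrt
        M_def[symmetric] L_def[symmetric] S_def[symmetric]
      using gen(2) True by blast
  qed
  then show ?few ?eq
    by auto
qed

text \<open>For \<open>t = 2\<close> the value of \<open>lambda_max\<close> is 1 if
  \<open>r = 2\<close>, and 2 if \<open>r = 3\<close>, where it is the limiting condition on
  \<open>l\<close>. From \<open>r = 4\<close> on it is at least \<open>2 * (q + 1)\<close>, and the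
  number of points limits \<open>l\<close> instead.\<close>

lemma few_blocks_Omega_plus:
  assumes q: "1 < q"
  shows "(t, r, k, l, Omega_plus) \<in> admissible_params q \<and>
           lambda_s q Omega_plus t r k l 0 \<le> polar_binomial q Omega_plus r 1
           \<longleftrightarrow> k = r \<and>
             (t = 2 \<and> (r = 2 \<and> l = 1 \<or> r = 3 \<and> l \<in> {1, 2} \<or> 4 \<le> r \<and> l \<in> {1..q + 1}) \<or>
              t = 3 \<and> l = 1 \<and> r \<in> {3, 4})" (is ?few)
    and "(t, r, k, l, Omega_plus) \<in> admissible_params q \<and>
           lambda_s q Omega_plus t r k l 0 = polar_binomial q Omega_plus r 1
           \<longleftrightarrow> k = r \<and> r = 4 \<and> (t = 2 \<and> l = q + 1 \<or> t = 3 \<and> l = 1)" (is ?eq)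
proof -
  let ?M = "\<Prod>i\<in>{1..r - t}. polar_factor q Omega_plus i"
  have h: "polar_factor q Omega_plus 1 = 2" "polar_factor q Omega_plus 2 = real q + 1"
    using polar_factor_Omega_plus[of q 0] polar_factor_Omega_plus[of q 1] q
    by (simp_all add: numeral_2_eq_2)
  have over: "polar_type_over q Omega_plus"
    by (simp add: polar_type_over_def)
  have M4: "real l \<le> ?M" if "t = 2" "4 \<le> r" "l \<le> q + 1"
  proof -
    have "{1, 2} \<subseteq> {1..r - t}"
      using that by auto
    from prod_polar_factor_ge[OF q order_refl this, of Omega_plus]
    have "2 * (real q + 1) \<le> ?M"
      using h by simp
    moreover have "real l \<le> real q + 1"
      using that by linarith
    ultimately show ?thesis
      by simp
  qed
  have M3: "real l \<le> ?M \<longleftrightarrow> l \<le> 2" if "t = 2" "r = 3"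
    using that h by simp
  have M2: "real l \<le> ?M \<longleftrightarrow> l \<le> 1" if "r = t"
    using that by simp
  have M1: "real l \<le> ?M" if "l = 1"
    using prod_polar_factor_ge_1[OF q, of Omega_plus "r - t"] that by simp
  define M where "M \<longleftrightarrow> real l \<le> ?M"
  have r: "t \<le> r \<Longrightarrow> t = 2 \<Longrightarrow> r = 2 \<or> r = 3 \<or> 4 \<le> r"
      "t \<le> r \<Longrightarrow> t = 3 \<Longrightarrow> r \<le> 4 \<Longrightarrow> r = 3 \<or> r = 4"
    and l: "1 \<le> l \<Longrightarrow> l \<le> 2 \<Longrightarrow> l = 1 \<or> l = 2"
    by linarith+
  define L where "L = real l * (\<Prod>i\<in>{r - t + 1..r - 1}. polar_factor q Omega_plus i)"
  define S where "S = (\<Sum>i<r. real q ^ i)"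
  note gen = few_generators_Omega_plus[OF q, of t r l, folded M_def L_def S_def]
  note Ms = M1[folded M_def] M2[folded M_def] M3[folded M_def] M4[folded M_def]
  have "(2 \<le> t \<and> t \<le> r \<and> 1 \<le> l \<and> M) \<and> L \<le> S \<longleftrightarrow>
      t = 2 \<and> (r = 2 \<and> l = 1 \<or> r = 3 \<and> (l = 1 \<or> l = 2) \<or> 4 \<le> r \<and> 1 \<le> l \<and> l \<le> q + 1) \<or>
      t = 3 \<and> l = 1 \<and> (r = 3 \<or> r = 4)"
    using gen(1) Ms r l by auto
  then show ?few
    unfolding few_blocks_iff[OF q] admissible_params_generators[OF q]
      M_def[symmetric] L_def[symmetric] S_def[symmetric]
    using over by auto
  have "(2 \<le> t \<and> t \<le> r \<and> 1 \<le> l \<and> M) \<and> L = S \<longleftrightarrow>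
      r = 4 \<and> (t = 2 \<and> l = q + 1 \<or> t = 3 \<and> l = 1)"
    using gen(2) Ms by auto
  then show ?eq
    unfolding few_blocks_iff[OF q] admissible_params_generators[OF q]
      M_def[symmetric] L_def[symmetric] S_def[symmetric]
    using over by blast
qed

section \<open>Union over all types, equality cases and reduced parameters\<close>

theorem lemma15:
  fixes q :: nat
  assumes "primepow q"
  shows "{(t, r, k, l, Q) \<in> admissible_params q.
            lambda_s q Q t r k l 0 \<le> polar_binomial q Q r 1} =
           {(2, r, r, 1, Q) | r Q. 2 \<le> r \<and> Q \<in> {Omega, Sp}} \<union>
           {(2, r, r, l, U_plus) | r l. polar_type_over q U_plus \<and>
              (r = 2 \<and> l = 1 \<or> 3 \<le> r \<and> 1 \<le> l \<and> real l \<le> sqrt (real q))} \<union>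
           {(2, r, r, l, Omega_plus) | r l.
              r = 2 \<and> l = 1 \<or> r = 3 \<and> l \<in> {1, 2} \<or> 4 \<le> r \<and> l \<in> {1..q + 1}} \<union>
           {(3, r, r, 1, Omega_plus) | r. r \<in> {3, 4}} \<and>
         {(t, r, k, l, Q) \<in> admissible_params q.
            lambda_s q Q t r k l 0 = polar_binomial q Q r 1} =
           {(2, 2, 2, 1, Omega), (2, 2, 2, 1, Sp), (3, 4, 4, 1, Omega_plus),
            (2, 4, 4, q + 1, Omega_plus)} \<and>
         reduced_params q (3, 4, 4, 1, Omega_plus) = (2, 4, 4, real (q + 1), Omega_plus)"
proof -
  have eps: "Sp \<in> {Omega, Sp}" "Omega \<in> {Omega, Sp}"
    by auto
  have q: "1 < q"
    using primepow_gt_Suc_0[OF assms] by simp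
  have minus: "\<not> lambda_s q Q t r k l 0 \<le> polar_binomial q Q r 1"
      "\<not> lambda_s q Q t r k l 0 = polar_binomial q Q r 1"
    if "(t, r, k, l, Q) \<in> admissible_params q" "Q \<in> {U_minus, Omega_minus}" for t r k l Q
    using many_blocks_minus[OF q that(2,1)] by auto
  \<comment> \<open>A pointwise form of the first set equation, so that the set equation itself
    becomes pure logic; \<open>U_minus\<close> and \<open>Omega_minus\<close> contribute
    nothing.\<close>
  have few_iff: "(t, r, k, l, Q) \<in> admissible_params q \<and>
      lambda_s q Q t r k l 0 \<le> polar_binomial q Q r 1 \<longleftrightarrow>
        k = r \<and> (t = 2 \<and> 2 \<le> r \<and> l = 1 \<and> Q \<in> {Omega, Sp} \<or>
          t = 2 \<and> Q = U_plus \<and> polar_type_over q U_plus \<and>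
            (r = 2 \<and> l = 1 \<or> 3 \<le> r \<and> 1 \<le> l \<and> real l \<le> sqrt (real q)) \<or>
          t = 2 \<and> Q = Omega_plus \<and>
            (r = 2 \<and> l = 1 \<or> r = 3 \<and> l \<in> {1, 2} \<or> 4 \<le> r \<and> l \<in> {1..q + 1}) \<or>
          t = 3 \<and> Q = Omega_plus \<and> l = 1 \<and> r \<in> {3, 4})" for t r k l Q
  proof (cases Q)
    case Sp
    show ?thesis
      unfolding Sp few_blocks_epsilon_0(1)[OF q eps(1)] by auto
  next
    case U_plus
    show ?thesis
      unfolding U_plus few_blocks_U_plus(1)[OF q] by auto
  next
    case U_minus
    then show ?thesis
      using minus(1)[of t r k l Q] by auto
  next
    case Omega_plus
    show ?thesis
      unfolding Omega_plus few_blocks_Omega_plus(1)[OF q] by auto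
  next
    case Omega
    show ?thesis
      unfolding Omega few_blocks_epsilon_0(1)[OF q eps(2)] by auto
  next
    case Omega_minus
    then show ?thesis
      using minus(1)[of t r k l Q] by auto
  qed
  have eq_iff: "(t, r, k, l, Q) \<in> admissible_params q \<and>
      lambda_s q Q t r k l 0 = polar_binomial q Q r 1 \<longleftrightarrow>
        (t, r, k, l, Q) \<in> {(2, 2, 2, 1, Omega), (2, 2, 2, 1, Sp), (3, 4, 4, 1, Omega_plus),
            (2, 4, 4, q + 1, Omega_plus)}" for t r k l Q
  proof (cases Q)
    case Sp
    show ?thesis
      unfolding Sp few_blocks_epsilon_0(2)[OF q eps(1)] by auto
  next
    case U_plus
    show ?thesis
      unfolding U_plus using few_blocks_U_plus(2)[OF q, of t r k l] by simp
  next
    case U_minus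
    then show ?thesis
      using minus(2)[of t r k l Q] by auto
  next
    case Omega_plus
    show ?thesis
      unfolding Omega_plus few_blocks_Omega_plus(2)[OF q] by auto
  next
    case Omega
    show ?thesis
      unfolding Omega few_blocks_epsilon_0(2)[OF q eps(2)] by auto
  next
    case Omega_minus
    then show ?thesis
      using minus(2)[of t r k l Q] by auto
  qed
  \<comment> \<open>Only the index 2 lies between \<open>r - t + 1\<close> and \<open>r - s\<close>,
    and its factor is \<open>q ^ 1 + 1\<close>.\<close>
  have "lambda_s q Omega_plus 3 4 4 1 2 = real (q + 1)"
    using lambda_s_generators[OF q, of 2 3 4 Omega_plus 1] polar_factor_Omega_plus[of q 1] q
    by (simp add: numeral_2_eq_2)
  then have "reduced_params q (3, 4, 4, 1, Omega_plus) = (2, 4, 4, real (q + 1), Omega_plus)"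
    by (simp add: reduced_params_def)
  moreover have "{(t, r, k, l, Q) \<in> admissible_params q.
            lambda_s q Q t r k l 0 = polar_binomial q Q r 1} =
           {(2, 2, 2, 1, Omega), (2, 2, 2, 1, Sp), (3, 4, 4, 1, Omega_plus),
            (2, 4, 4, q + 1, Omega_plus)}"
  proof (rule set_eqI)
    fix p :: "nat \<times> nat \<times> nat \<times> nat \<times> polar_type"
    obtain t r k l Q where p: "p = (t, r, k, l, Q)"
      by (cases p)
    show "p \<in> {(t, r, k, l, Q) \<in> admissible_params q.
            lambda_s q Q t r k l 0 = polar_binomial q Q r 1} \<longleftrightarrow>
        p \<in> {(2, 2, 2, 1, Omega), (2, 2, 2, 1, Sp), (3, 4, 4, 1, Omega_plus),
            (2, 4, 4, q + 1, Omega_plus)}"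
      unfolding p mem_Collect_eq case_prod_conv eq_iff ..
  qed
  moreover have "{(t, r, k, l, Q) \<in> admissible_params q.
            lambda_s q Q t r k l 0 \<le> polar_binomial q Q r 1} =
           {(2, r, r, 1, Q) | r Q. 2 \<le> r \<and> Q \<in> {Omega, Sp}} \<union>
           {(2, r, r, l, U_plus) | r l. polar_type_over q U_plus \<and>
              (r = 2 \<and> l = 1 \<or> 3 \<le> r \<and> 1 \<le> l \<and> real l \<le> sqrt (real q))} \<union>
           {(2, r, r, l, Omega_plus) | r l.
              r = 2 \<and> l = 1 \<or> r = 3 \<and> l \<in> {1, 2} \<or> 4 \<le> r \<and> l \<in> {1..q + 1}} \<union>
           {(3, r, r, 1, Omega_plus) | r. r \<in> {3, 4}}" (is "?A = ?B")
  proof (rule set_eqI)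
    fix p :: "nat \<times> nat \<times> nat \<times> nat \<times> polar_type"
    obtain t r k l Q where p: "p = (t, r, k, l, Q)"
      by (cases p)
    show "p \<in> ?A \<longleftrightarrow> p \<in> ?B"
      unfolding p mem_Collect_eq case_prod_conv few_iff Un_iff prod.inject by blast
  qed
  ultimately show ?thesis
    by (intro conjI)
qed

end
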